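(* For each $n\in\{1,\ldots,8\}$ and every integer $m\ge n$: \begin{align*} c_{1,m}(1)&=1,\\ c_{2,m}(1)&=\tbinom{m}{1},\\ c_{3,m}(1)&=\tbinom{m}{1}+\tbinom{m}{2},\\ c_{4,m}(1)&=\tbinom{m}{1}+4\tbinom{m}{2}+\tbinom{m}{3},\\ c_{5,m}(1)&=\tbinom{m}{1}+8\tbinom{m}{2}+13\tbinom{m}{3}+\tbinom{m}{4},\\ c_{6,m}(1)&=\tbinom{m}{1}+18\tbinom{m}{2}+48\tbinom{m}{3}+41\tbinom{m}{4}+\tbinom{m}{5},\\ c_{7,m}(1)&=\tbinom{m}{1}+33\tbinom{m}{2}+178\tbinom{m}{3}+262\tbinom{m}{4}+131\tbinom{m}{5}+\tbinom{m}{6},\\ c_{8,m}(1)&=\tbinom{m}{1}+68\tbinom{m}{2}+549\tbinom{m}{3}+1480\tbinom{m}{4}+1405\tbinom{m}{5}+428\tbinom{m}{6}+\tbinom{m}{7}. \end{align*}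
   Context: $c_{n,m}(1)$ is the number of words $w\in\{1,\ldots,m\}^n$ such that $1w\equiv w1$, where $\equiv$ is Knuth equivalence (equivalently, $P(1w)=P(w1)$ for RSK insertion tableaux). *)

theory Defs
  imports Main
begin

text \<open>Words are lists. The elementary Knuth relations, applied inside a word, are
  \<open>yzx \<sim> yxz\<close> for \<open>x < y \<le> z\<close> and \<open>xzy \<sim> zxy\<close> for \<open>x \<le> y < z\<close>. This is the convention
  matching RSK row insertion, where rows are weakly increasing.\<close>

inductive knuth_step :: "'a::linorder list \<Rightarrow> 'a list \<Rightarrow> bool" where
  "x < y \<Longrightarrow> y \<le> z \<Longrightarrow> knuth_step (u @ [y, z, x] @ v) (u @ [y, x, z] @ v)"
| "x \<le> y \<Longrightarrow> y < z \<Longrightarrow> knuth_step (u @ [x, z, y] @ v) (u @ [z, x, y] @ v)"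

definition knuth_equiv :: "'a::linorder list \<Rightarrow> 'a list \<Rightarrow> bool" (infix "\<equiv>\<^sub>K" 50) where
  "u \<equiv>\<^sub>K w \<longleftrightarrow> equivclp knuth_step u w"

definition centralizer_count :: "nat \<Rightarrow> nat \<Rightarrow> nat list \<Rightarrow> nat" where
  "centralizer_count n m u =
     card {w. length w = n \<and> set w \<subseteq> {1..m} \<and> u @ w \<equiv>\<^sub>K w @ u}"

end

(* Only the first row of P(w) matters. Row insertion of a word w, with the bumped letters collected
   to the left, rewrites w to (bumped word)(first row) by Knuth moves. A leading 1 is never bumped
   and does not influence which letters are, so 1w is equivalent to (bumped word) 1 (first row), while
   w1 is equivalent to (bumped word)(first row) 1. Comparing first rows, 1w and w1 are equivalent iff
   the first row of w consists of ones.

   Such words are counted by their set of letters: c_{n,m}(1) is the sum over k of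
   binom(m-1,k) times the number of such words with letter set {1,...,k+1}. For fixed n <= 8 these
   numbers are recovered from c_{n,1}(1), ..., c_{n,n}(1), which are computed by dynamic programming
   on the part of the first row that differs from 1: inserting 1 deletes its smallest entry. *)

theory Submission
  imports Defs "HOL-Library.Infinite_Set"
begin

section \<open>Row insertion, restricted to the first row\<close>

text \<open>The bumped letter is discarded, so folding this over a word yields the first row of its
  insertion tableau without building the lower rows.\<close>

fun row_insert :: "'a::linorder \<Rightarrow> 'a list \<Rightarrow> 'a list" where
  "row_insert a [] = [a]"
| "row_insert a (b # r) = (if a < b then a # r else b # row_insert a r)"

definition first_row :: "'a::linorder list \<Rightarrow> 'a list" where
  "first_row w = fold row_insert w []"

lemma set_row_insert: "set (row_insert a r) \<subseteq> insert a (set r)"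
  by (induction r) auto

lemma sorted_row_insert: "sorted r \<Longrightarrow> sorted (row_insert a r)"
  using set_row_insert by (induction r) fastforce+

lemma row_insert_neq_Nil: "row_insert a r \<noteq> []"
  by (cases r) auto

lemma sorted_fold_row_insert: "sorted r \<Longrightarrow> sorted (fold row_insert w r)"
  by (induction w arbitrary: r) (auto simp: sorted_row_insert)

lemma set_fold_row_insert: "set (fold row_insert w r) \<subseteq> set w \<union> set r"
proof (induction w arbitrary: r)
  case (Cons a w)
  then show ?case
    using Cons[of "row_insert a r"] set_row_insert[of a r] by auto
qed auto

lemma first_row_neq_Nil: "w \<noteq> [] \<Longrightarrow> first_row w \<noteq> []"
  by (cases w rule: rev_cases) (auto simp: first_row_def row_insert_neq_Nil)

section \<open>Invariance of the first row under Knuth moves\<close>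

text \<open>Once \<open>y\<close> sits in the row, \<open>z\<close> lands strictly to its right,
  while \<open>x\<close> lands in the cell of \<open>y\<close> or further left; hence the two
  insertions do not interfere.\<close>

lemma row_insert_yzx:
  assumes "sorted r" "x < y" "y \<le> z"
  shows "row_insert x (row_insert z (row_insert y r)) = row_insert z (row_insert x (row_insert y r))"
  using assms by (induction r) auto

text \<open>The order of \<open>x\<close> and \<open>z\<close> matters only if both aim at the same
  cell. Then \<open>x\<close> ends up in that cell in either order, and \<open>y\<close> takes the
  next one.\<close>

lemma row_insert_xzy:
  assumes "sorted r" "x \<le> y" "y < z"
  shows "row_insert y (row_insert z (row_insert x r)) = row_insert y (row_insert x (row_insert z r))"
proof -
  \<comment> \<open>This is the colliding case: \<open>s\<close> is the row to the right of
    \<open>x\<close>, where \<open>y\<close> takes the cell of \<open>z\<close> and so erases its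
    effect.\<close>
  have "row_insert y (row_insert z s) = row_insert y s" if "\<forall>b\<in>set s. z < b" for s
    using that assms(3) by (cases s) auto
  then show ?thesis
    using assms by (induction r) fastforce+
qed

lemma first_row_knuth_step: "knuth_step u w \<Longrightarrow> first_row u = first_row w"
proof (induction rule: knuth_step.induct)
  case (1 x y z u v)
  then show ?case
    using row_insert_yzx[of "fold row_insert u []" x y z]
    by (simp add: first_row_def sorted_fold_row_insert)
next
  case (2 x y z u v)
  then show ?case
    using row_insert_xzy[of "fold row_insert u []" x y z]
    by (simp add: first_row_def sorted_fold_row_insert)
qed

lemma first_row_knuth_equiv: "u \<equiv>\<^sub>K w \<Longrightarrow> first_row u = first_row w"
  unfolding knuth_equiv_def
  by (induction rule: equivclp_induct) (auto dest: first_row_knuth_step)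

section \<open>Knuth equivalence as a congruence on words\<close>

lemma knuth_equiv_refl: "w \<equiv>\<^sub>K w"
  by (simp add: knuth_equiv_def)

lemma knuth_equiv_sym: "u \<equiv>\<^sub>K w \<Longrightarrow> w \<equiv>\<^sub>K u"
  by (simp add: knuth_equiv_def equivclp_sym)

lemma knuth_equiv_trans [trans]: "u \<equiv>\<^sub>K v \<Longrightarrow> v \<equiv>\<^sub>K w \<Longrightarrow> u \<equiv>\<^sub>K w"
  unfolding knuth_equiv_def by (rule equivclp_trans)

lemma knuth_step_append: "knuth_step u w \<Longrightarrow> knuth_step (p @ u @ s) (p @ w @ s)"
proof (induction rule: knuth_step.induct)
  case (1 x y z u v)
  then show ?case using knuth_step.intros(1)[of x y z "p @ u" "v @ s"] by simp
next
  case (2 x y z u v)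
  then show ?case using knuth_step.intros(2)[of x y z "p @ u" "v @ s"] by simp
qed

lemma knuth_equiv_append: "u \<equiv>\<^sub>K w \<Longrightarrow> p @ u @ s \<equiv>\<^sub>K p @ w @ s"
  unfolding knuth_equiv_def
proof (induction rule: equivclp_induct)
  case (step y z)
  then show ?case
    by (meson equivclp_into_equivclp knuth_step_append)
qed simp

lemma knuth_equiv_yzx:
  assumes "x < y" "y \<le> z"
  shows "u @ [y, z, x] @ v \<equiv>\<^sub>K u @ [y, x, z] @ v"
  unfolding knuth_equiv_def using assms by (intro r_into_equivclp knuth_step.intros)

lemma knuth_equiv_xzy:
  assumes "x \<le> y" "y < z"
  shows "u @ [x, z, y] @ v \<equiv>\<^sub>K u @ [z, x, y] @ v"
  unfolding knuth_equiv_def using assms by (intro r_into_equivclp knuth_step.intros)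

section \<open>Rewriting a word into its bumped letters followed by its first row\<close>

text \<open>A list of at most one letter, so that an insertion that bumps nothing contributes the
  empty word to a concatenation.\<close>

fun bumped :: "'a::linorder \<Rightarrow> 'a list \<Rightarrow> 'a list" where
  "bumped a [] = []"
| "bumped a (b # r) = (if a < b then [b] else bumped a r)"

fun bumped_word :: "'a::linorder list \<Rightarrow> 'a list \<Rightarrow> 'a list" where
  "bumped_word [] r = []"
| "bumped_word (a # w) r = bumped a r @ bumped_word w (row_insert a r)"

text \<open>The letter \<open>a\<close> travels left through \<open>r\<close>, passing one letter
  \<open>z\<close> at a time by the move \<open>y z a ~ y a z\<close>, where \<open>y\<close>
  precedes \<open>z\<close>.\<close>

lemma knuth_equiv_bump_head:
  assumes "sorted (b # r)" "a < b"
  shows "b # r @ [a] \<equiv>\<^sub>K b # a # r"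
  using assms
proof (induction r rule: rev_induct)
  case Nil
  then show ?case by (simp add: knuth_equiv_refl)
next
  case (snoc z r)
  \<comment> \<open>The letter just before \<open>z\<close>; it is \<open>b\<close> itself when
    \<open>r\<close> is empty.\<close>
  obtain u y where u: "b # r = u @ [y]"
    by (metis append_butlast_last_id list.discI)
  then have y: "y \<in> set (b # r)" by simp
  then have "a < y" "y \<le> z"
    using snoc.prems by (auto simp: sorted_append)
  then have "u @ [y, z, a] @ [] \<equiv>\<^sub>K u @ [y, a, z] @ []"
    by (rule knuth_equiv_yzx)
  then have "b # (r @ [z]) @ [a] \<equiv>\<^sub>K b # r @ [a, z]"
    using u by (metis append.assoc append.right_neutral append_Cons append_Nil)
  also have "b # r @ [a, z] \<equiv>\<^sub>K b # a # r @ [z]"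
    using snoc knuth_equiv_append[of "b # r @ [a]" "b # a # r" "[]" "[z]"]
    by (simp add: sorted_append)
  finally show ?case by simp
qed

text \<open>Induction from the left end of the row. If \<open>a\<close> does not bump the first
  entry \<open>b\<close>, the letter bumped out of the tail still has to cross
  \<open>b\<close>.\<close>

lemma knuth_equiv_row_insert:
  assumes "sorted r"
  shows "r @ [a] \<equiv>\<^sub>K bumped a r @ row_insert a r"
  using assms
proof (induction r)
  case Nil
  then show ?case by (simp add: knuth_equiv_refl)
next
  case (Cons b r)
  show ?case
  proof (cases "a < b")
    case True
    then show ?thesis using knuth_equiv_bump_head[of b r a] Cons.prems by simp
  next
    case False
    have 1: "b # r @ [a] \<equiv>\<^sub>K b # bumped a r @ row_insert a r"
      using Cons knuth_equiv_append[of "r @ [a]" "bumped a r @ row_insert a r" "[b]" "[]"]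
      by simp
    have bumped: "bumped a r = [] \<or> (\<exists>c. bumped a r = [c] \<and> a < c)" for r
      by (induction r) auto
    from bumped[of r] show ?thesis
    proof
      assume "bumped a r = []"
      then show ?thesis using 1 False by simp
    next
      assume "\<exists>c. bumped a r = [c] \<and> a < c"
      then obtain c where c: "bumped a r = [c]" "a < c" by blast
      \<comment> \<open>The head \<open>d\<close> of the new tail satisfies
        \<open>b \<le> d \<le> a < c\<close>, so \<open>b c d ~ c b d\<close> carries
        \<open>c\<close> past \<open>b\<close>.\<close>
      obtain d s where d: "row_insert a r = d # s"
        using row_insert_neq_Nil by (meson neq_Nil_conv)
      have "d \<le> a"
        using d by (cases r) (auto split: if_splits)
      moreover have "b \<le> d"
        using Cons.prems set_row_insert[of a r] d False by auto
      ultimately have "[] @ [b, c, d] @ s \<equiv>\<^sub>K [] @ [c, b, d] @ s"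
        using c by (intro knuth_equiv_xzy) auto
      then show ?thesis using 1 False c d by (auto intro: knuth_equiv_trans)
    qed
  qed
qed

text \<open>Iterates single insertions. The bumped letters are kept in the order in which they leave
  the row and are not inserted any further.\<close>

lemma knuth_equiv_bumped_word:
  "sorted r \<Longrightarrow> r @ w \<equiv>\<^sub>K bumped_word w r @ fold row_insert w r"
proof (induction w arbitrary: r)
  case Nil
  then show ?case by (simp add: knuth_equiv_refl)
next
  case (Cons a w)
  have "r @ a # w \<equiv>\<^sub>K bumped a r @ row_insert a r @ w"
    using knuth_equiv_append[OF knuth_equiv_row_insert[OF Cons.prems], of "[]" a w] by simp
  also have "\<dots> \<equiv>\<^sub>K bumped a r @ bumped_word w (row_insert a r) @ fold row_insert w (row_insert a r)"
    using knuth_equiv_append[OF Cons.IH[OF sorted_row_insert[OF Cons.prems]], of "bumped a r" a "[]"]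
    by simp
  finally show ?case by simp
qed

section \<open>Words commuting with a letter that bounds them from below\<close>

lemma fold_row_insert_Cons_least:
  assumes "\<forall>a\<in>set w. c \<le> a"
  shows "fold row_insert w (c # r) = c # fold row_insert w r"
    and "bumped_word w (c # r) = bumped_word w r"
  using assms by (induction w arbitrary: r) (auto simp: not_less)

lemma knuth_commute_least_iff:
  assumes "\<forall>a\<in>set w. c \<le> a"
  shows "[c] @ w \<equiv>\<^sub>K w @ [c] \<longleftrightarrow> set (first_row w) \<subseteq> {c}"
proof
  have r1: "first_row ([c] @ w) = c # first_row w"
    using fold_row_insert_Cons_least[OF assms, of "[]"] by (simp add: first_row_def)
  have r2: "first_row (w @ [c]) = row_insert c (first_row w)"
    by (simp add: first_row_def)
  \<comment> \<open>An insertion that bumps keeps the length, whereas \<open>c # first_row w\<close>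
    is one longer than \<open>first_row w\<close>; so no entry can exceed \<open>c\<close>.\<close>
  have len: "length (row_insert c r) = length r" if "\<exists>b\<in>set r. c < b" for r :: "'a list"
    using that by (induction r) auto
  have ge: "\<forall>b\<in>set (first_row w). c \<le> b"
    using assms set_fold_row_insert[of w "[]"] by (auto simp: first_row_def)
  assume "[c] @ w \<equiv>\<^sub>K w @ [c]"
  then have "c # first_row w = row_insert c (first_row w)"
    using first_row_knuth_equiv r1 r2 by metis
  then have "\<not> (\<exists>b\<in>set (first_row w). c < b)"
    using len by (metis length_Cons n_not_Suc_n)
  then show "set (first_row w) \<subseteq> {c}"
    using ge by force
next
  assume "set (first_row w) \<subseteq> {c}"
  \<comment> \<open>A constant row lets \<open>c\<close> pass from its front to its end as an
    equality of words.\<close>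
  then have rep: "first_row w = replicate (length (first_row w)) c"
    by (metis replicate_eqI singletonD subsetD)
  have "[c] @ w \<equiv>\<^sub>K bumped_word w [] @ c # first_row w"
    using knuth_equiv_bumped_word[of "[c]" w] fold_row_insert_Cons_least[OF assms, of "[]"]
    by (simp add: first_row_def)
  also have "c # first_row w = first_row w @ [c]"
    by (subst (1 2) rep) (simp add: replicate_append_same)
  also have "bumped_word w [] @ first_row w @ [c] \<equiv>\<^sub>K w @ [c]"
    using knuth_equiv_append[OF knuth_equiv_sym[OF knuth_equiv_bumped_word[of "[]" w]], of "[]" "[c]"]
    by (simp add: first_row_def)
  finally show "[c] @ w \<equiv>\<^sub>K w @ [c]" .
qed

section \<open>Counting by letter sets\<close>

definition ones_row_words :: "nat \<Rightarrow> nat set \<Rightarrow> nat list set" where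
  "ones_row_words n A = {w. length w = n \<and> set w \<subseteq> A \<and> set (first_row w) \<subseteq> {1}}"

definition packed_words :: "nat \<Rightarrow> nat set \<Rightarrow> nat list set" where
  "packed_words n A = {w. length w = n \<and> set w = A \<and> set (first_row w) \<subseteq> {1}}"

text \<open>The index \<open>k\<close> is the number of letters other than 1.\<close>

definition packed_count :: "nat \<Rightarrow> nat \<Rightarrow> nat" where
  "packed_count n k = card (packed_words n {1..Suc k})"

lemma finite_packed_words: "finite A \<Longrightarrow> finite (packed_words n A)"
  by (rule finite_subset[OF _ finite_lists_length_eq[of A n]]) (auto simp: packed_words_def)

lemma centralizer_count_one:
  "centralizer_count n m [1] = card (ones_row_words n {1..m})"
proof -
  have "[1] @ w \<equiv>\<^sub>K w @ [1] \<longleftrightarrow> set (first_row w) \<subseteq> {1}" if "set w \<subseteq> {1..m}" for w :: "nat list"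
    using that by (intro knuth_commute_least_iff) auto
  then show ?thesis
    unfolding centralizer_count_def ones_row_words_def
    by (intro arg_cong[of _ _ card]) blast
qed

text \<open>Insertion only compares letters, so increasing relabellings commute with it.\<close>

lemma row_insert_map:
  assumes "strict_mono_on A h" "insert a (set r) \<subseteq> A"
  shows "row_insert (h a) (map h r) = map h (row_insert a r)"
  using assms(2)
proof (induction r)
  case (Cons b r)
  then have "h a < h b \<longleftrightarrow> a < b"
    using strict_mono_on_less[OF assms(1)] by simp
  then show ?case using Cons by simp
qed simp

lemma fold_row_insert_map:
  assumes "strict_mono_on A h" "set w \<union> set r \<subseteq> A"
  shows "fold row_insert (map h w) (map h r) = map h (fold row_insert w r)"
  using assms(2)
proof (induction w arbitrary: r)
  case (Cons a w)
  then show ?case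
    using row_insert_map[OF assms(1), of a r] set_row_insert[of a r] by auto
qed simp

lemma first_row_map:
  "strict_mono_on (set w) h \<Longrightarrow> first_row (map h w) = map h (first_row w)"
  using fold_row_insert_map[of "set w" h w "[]"] by (simp add: first_row_def)

text \<open>The increasing bijection from \<open>{1..Suc (card S)}\<close> onto
  \<open>insert 1 S\<close> fixes 1, the least element of both, and therefore preserves the
  condition on the first row.\<close>

lemma card_packed_words:
  assumes "finite S" "\<forall>a\<in>S. 1 < a"
  shows "card (packed_words n (insert 1 S)) = packed_count n (card S)"
proof -
  let ?M = "insert 1 S" and ?I = "{1..Suc (card S)}"
  have "card ?M = Suc (card S)" using assms by auto
  then obtain g where g: "bij_betw g {..<Suc (card S)} ?M" "strict_mono_on {..<Suc (card S)} g"
    using ex_bij_betw_strict_mono_card[of ?M] assms(1) by (metis finite_insert)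
  \<comment> \<open>\<open>g\<close> is indexed from 0, the letters from 1.\<close>
  define h where "h i = g (i - 1)" for i
  have "bij_betw (\<lambda>i. i - 1) ?I {..<Suc (card S)}"
    by (rule bij_betw_byWitness[where f' = Suc]) auto
  then have bij: "bij_betw h ?I ?M"
    using bij_betw_trans[OF _ g(1)] by (simp add: h_def[abs_def] o_def)
  have mono: "strict_mono_on ?I h"
  proof (rule strict_mono_onI)
    show "h i < h j" if "i \<in> ?I" "j \<in> ?I" "i < j" for i j
      unfolding h_def using that by (intro strict_mono_onD[OF g(2)]) auto
  qed
  have inj: "inj_on h ?I" and im: "h ` ?I = ?M"
    using bij by (simp_all only: bij_betw_def)
  have h1: "h 1 = 1"
  proof -
    have "1 \<in> h ` ?I" unfolding im by simp
    then obtain j where j: "j \<in> ?I" "h j = 1" by (metis imageE)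
    then have "h 1 \<le> h j"
      using strict_mono_on_leD[OF mono, of 1 j] by simp
    moreover have "h 1 \<in> ?M" unfolding im[symmetric] by (rule imageI) simp
    then have "1 \<le> h 1" using assms(2) by auto
    ultimately show ?thesis using j by simp
  qed
  have ones: "set (first_row (map h w)) \<subseteq> {1} \<longleftrightarrow> set (first_row w) \<subseteq> {1}"
    if "set w = ?I" for w
  proof -
    have sub: "set (first_row w) \<subseteq> ?I"
      using set_fold_row_insert[of w "[]"] that by (simp add: first_row_def)
    have "h a = 1 \<longleftrightarrow> a = 1" if "a \<in> set (first_row w)" for a
      using that sub inj_onD[OF inj, of a 1] h1 by auto
    then show ?thesis
      using first_row_map[of w h] mono that by auto
  qed
  have "packed_words n ?M = map h ` packed_words n ?I"
  proof (intro equalityI subsetI)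
    fix w assume w: "w \<in> packed_words n ?M"
    define v where "v = map (inv_into ?I h) w"
    have wM: "set w = h ` ?I" using w im by (simp add: packed_words_def)
    have hv: "map h v = w"
      unfolding v_def map_map by (rule map_idI) (use wM in \<open>simp add: f_inv_into_f\<close>)
    have "set v = ?I"
      unfolding v_def using wM inj by (simp add: inv_into_image_cancel)
    then have "v \<in> packed_words n ?I"
      using w hv ones[of v] by (auto simp: packed_words_def)
    then show "w \<in> map h ` packed_words n ?I" using hv by blast
  next
    fix w assume "w \<in> map h ` packed_words n ?I"
    then obtain v where v: "w = map h v" "v \<in> packed_words n ?I" by (rule imageE)
    then have "set v = ?I" by (simp add: packed_words_def)
    moreover from this have "set w = ?M" unfolding v(1) list.set_map by (simp only: im)
    ultimately show "w \<in> packed_words n ?M"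
      using v ones[of v] by (simp add: packed_words_def)
  qed
  moreover have "inj_on (map h) (packed_words n ?I)"
  proof (rule inj_onI)
    fix v w assume "v \<in> packed_words n ?I" "w \<in> packed_words n ?I" "map h v = map h w"
    moreover from this have "set v \<union> set w = ?I" by (simp add: packed_words_def)
    ultimately show "v = w" using inj by (simp only: inj_on_map_eq_map)
  qed
  ultimately show ?thesis by (simp add: card_image packed_count_def)
qed

text \<open>Groups the words by their set \<open>S\<close> of letters other than 1. Each
  \<open>S\<close> of size \<open>k\<close> contributes \<open>packed_count n k\<close>, and there
  are \<open>m - 1 choose k\<close> such sets in \<open>{2..m}\<close>.\<close>

lemma card_ones_row_words:
  assumes "0 < n" "0 < m"
  shows "card (ones_row_words n {1..m}) =
    (\<Sum>k<n. (m - 1 choose k) * packed_count n k)"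
proof -
  define F where "F k = {S. S \<subseteq> {2..m} \<and> card S = k}" for k
  have finF: "finite (F k)" for k
    unfolding F_def by simp
  have F: "finite S" "\<forall>a\<in>S. 1 < a" "card S = k" if "S \<in> F k" for S k
    using that finite_subset by (fastforce simp: F_def)+
  have eq: "ones_row_words n {1..m} =
      (\<Union>k<n. \<Union>S\<in>F k. packed_words n (insert 1 S))"
    (is "?L = ?R")
  proof (intro equalityI subsetI)
    fix w assume w: "w \<in> ?L"
    \<comment> \<open>As \<open>0 < n\<close>, the first row is nonempty; consisting of ones, it
      forces 1 to occur in \<open>w\<close>, which leaves fewer than \<open>n\<close> other
      letters.\<close>
    have "set (first_row w) \<noteq> {}"
      using w assms first_row_neq_Nil[of w] by (auto simp: ones_row_words_def)
    then have one: "1 \<in> set w"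
      using w set_fold_row_insert[of w "[]"]
      by (auto simp: ones_row_words_def first_row_def subset_singleton_iff)
    have "set w - {1} \<in> F (card (set w - {1}))"
      using w by (auto simp: ones_row_words_def F_def)
    moreover have "card (set w - {1}) < n"
      using one w card_length[of w] card_Diff1_less[of "set w" 1]
      by (auto simp: ones_row_words_def)
    moreover have "w \<in> packed_words n (insert 1 (set w - {1}))"
      using w one by (auto simp: ones_row_words_def packed_words_def)
    ultimately show "w \<in> ?R"
      by blast
  next
    fix w assume "w \<in> ?R"
    then show "w \<in> ?L"
      using assms(2) by (fastforce simp: F_def packed_words_def ones_row_words_def)
  qed
  have disj: "packed_words n (insert 1 S) \<inter> packed_words n (insert 1 S') = {}"
    if "S \<in> F k" "S' \<in> F k'" "S \<noteq> S'" for S S' k k'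
  proof -
    have "insert 1 S \<noteq> insert 1 S'"
      using F[OF that(1)] F[OF that(2)] that(3) by (metis insert_ident less_irrefl)
    then show ?thesis by (auto simp: packed_words_def)
  qed
  have "card (ones_row_words n {1..m}) =
      (\<Sum>k<n. card (\<Union>S\<in>F k. packed_words n (insert 1 S)))"
    unfolding eq
  proof (intro card_UN_disjoint ballI impI)
    fix i j assume "i \<noteq> (j::nat)"
    then have "packed_words n (insert 1 S) \<inter> packed_words n (insert 1 S') = {}"
      if "S \<in> F i" "S' \<in> F j" for S S'
      using disj[OF that] F(3)[OF that(1)] F(3)[OF that(2)] by blast
    then show "(\<Union>S\<in>F i. packed_words n (insert 1 S)) \<inter> (\<Union>S\<in>F j. packed_words n (insert 1 S)) = {}"
      by blast
  next
    fix k
    show "finite (\<Union>S\<in>F k. packed_words n (insert 1 S))"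
      using finF F(1) finite_packed_words by simp
  qed simp
  also have "\<dots> = (\<Sum>k<n. \<Sum>S\<in>F k. card (packed_words n (insert 1 S)))"
  proof (intro sum.cong card_UN_disjoint refl ballI impI)
    show "finite (packed_words n (insert 1 S))" if "S \<in> F k" for S k
      using that F(1) finite_packed_words by simp
  qed (use finF disj in auto)
  also have "\<dots> = (\<Sum>k<n. \<Sum>S\<in>F k. packed_count n k)"
  proof (intro sum.cong refl)
    fix k S assume "S \<in> F k"
    then show "card (packed_words n (insert 1 S)) = packed_count n k"
      using F[of S k] card_packed_words[of S n] by simp
  qed
  also have "\<dots> = (\<Sum>k<n. (m - 1 choose k) * packed_count n k)"
    using n_subsets[of "{2..m}"] by (simp add: F_def)
  finally show ?thesis .
qed

section \<open>Counting by dynamic programming\<close>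

text \<open>\<open>clearing_count A t x\<close> counts the words of length \<open>t\<close> over \<open>{1} \<union> A\<close> that bump away all entries of a
  first row whose non-one part is \<open>x\<close>. It is an integer because \<open>code_simp\<close> computes in unary on
  natural numbers.\<close>

fun clearing_count :: "nat list \<Rightarrow> nat \<Rightarrow> nat list \<Rightarrow> int" where
  "clearing_count A 0 x = (if x = [] then 1 else 0)"
| "clearing_count A (Suc t) x =
     clearing_count A t (tl x) + (\<Sum>a\<leftarrow>A. clearing_count A t (row_insert a x))"

text \<open>An inserted \<open>c\<close> replaces the first entry different from \<open>c\<close>.
  If there is none, the row just grows by \<open>c\<close>, in agreement with
  \<open>tl [] = []\<close>.\<close>

lemma filter_row_insert:
  assumes "\<forall>b\<in>set (a # r). c \<le> b"
  shows "filter (\<lambda>b. b \<noteq> c) (row_insert a r) =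
    (if a = c then tl (filter (\<lambda>b. b \<noteq> c) r) else row_insert a (filter (\<lambda>b. b \<noteq> c) r))"
  using assms by (induction r) auto

text \<open>Splits the words by their first letter. The non-one part of the row evolves
  independently of the ones, so it serves as the state of the recursion.\<close>

lemma card_clearing_words:
  assumes "distinct A" "\<forall>a\<in>set A. 1 < a" "\<forall>a\<in>set r. 1 \<le> a"
  shows "int (card {w. length w = t \<and> set w \<subseteq> insert 1 (set A) \<and> set (fold row_insert w r) \<subseteq> {1}})
    = clearing_count A t (filter (\<lambda>a. a \<noteq> 1) r)"
  using assms(3)
proof (induction t arbitrary: r)
  case 0
  have "{w. length w = 0 \<and> set w \<subseteq> insert 1 (set A) \<and> set (fold row_insert w r) \<subseteq> {1}}
      = (if set r \<subseteq> {1} then {[]} else {})"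
    by auto
  moreover have "filter (\<lambda>a. a \<noteq> 1) r = [] \<longleftrightarrow> set r \<subseteq> {1}"
    by (auto simp: filter_empty_conv)
  ultimately show ?case by simp
next
  case (Suc t)
  let ?B = "insert 1 (set A)"
  let ?W = "\<lambda>t r. {w. length w = t \<and> set w \<subseteq> ?B \<and> set (fold row_insert w r) \<subseteq> {1}}"
  have IH: "int (card (?W t (row_insert a r))) =
      clearing_count A t (filter (\<lambda>a. a \<noteq> 1) (row_insert a r))" if "a \<in> ?B" for a
    using that assms(2) Suc.prems set_row_insert[of a r] by (intro Suc.IH) fastforce
  have filt: "filter (\<lambda>a. a \<noteq> 1) (row_insert a r) =
      (if a = 1 then tl (filter (\<lambda>a. a \<noteq> 1) r) else row_insert a (filter (\<lambda>a. a \<noteq> 1) r))"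
    if "a \<in> ?B" for a
    using that assms(2) Suc.prems by (intro filter_row_insert) fastforce
  have "?W (Suc t) r = (\<Union>a\<in>?B. (#) a ` ?W t (row_insert a r))"
  proof (intro equalityI subsetI)
    fix w assume w: "w \<in> ?W (Suc t) r"
    then obtain a v where "w = a # v" by (auto simp: length_Suc_conv)
    then show "w \<in> (\<Union>a\<in>?B. (#) a ` ?W t (row_insert a r))"
      using w by (intro UN_I[of a]) auto
  qed auto
  also have "card \<dots> = (\<Sum>a\<in>?B. card ((#) a ` ?W t (row_insert a r)))"
  proof (intro card_UN_disjoint ballI impI)
    fix a
    show "finite ((#) a ` ?W t (row_insert a r))"
      by (intro finite_imageI finite_subset[OF _ finite_lists_length_eq[of ?B t]]) auto
  qed auto
  also have "\<dots> = (\<Sum>a\<in>?B. card (?W t (row_insert a r)))"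
    by (simp add: card_image)
  also have "int \<dots> = (\<Sum>a\<in>?B. clearing_count A t (filter (\<lambda>a. a \<noteq> 1) (row_insert a r)))"
    unfolding of_nat_sum using IH by (intro sum.cong refl)
  also have "\<dots> = clearing_count A t (tl (filter (\<lambda>a. a \<noteq> 1) r)) +
      (\<Sum>a\<in>set A. clearing_count A t (row_insert a (filter (\<lambda>a. a \<noteq> 1) r)))"
    using assms(2) filt by (subst sum.insert) (auto intro!: sum.cong)
  also have "\<dots> = clearing_count A (Suc t) (filter (\<lambda>a. a \<noteq> 1) r)"
    using assms(1) by (simp add: sum_list_distinct_conv_sum_set)
  finally show ?case .
qed

lemma card_ones_row_words_clearing:
  assumes "distinct A" "\<forall>a\<in>set A. 1 < a"
  shows "int (card (ones_row_words n (insert 1 (set A)))) = clearing_count A n []"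
  using card_clearing_words[OF assms, of "[]" n] by (simp add: ones_row_words_def first_row_def)

text \<open>Each step shortens the list by at most one entry, so \<open>t\<close> steps cannot clear
  more than \<open>t\<close> entries.\<close>

lemma clearing_count_eq_0: "t < length x \<Longrightarrow> clearing_count A t x = 0"
proof (induction t arbitrary: x)
  case (Suc t)
  have "length x \<le> length (row_insert a x)" for a
    by (induction x) auto
  then have "t < length (row_insert a x)" for a
    using Suc.prems by (meson Suc_lessD le_trans less_le_trans)
  then show ?case using Suc by (simp add: sum_list_0)
qed auto

section \<open>Tabulation in tries\<close>

text \<open>A trie tabulates \<open>clearing_count A t\<close> on weakly increasing lists; lookups beyond its depth give 0.\<close>

datatype trie = Node int "(nat \<times> trie) list"

fun lookup :: "trie \<Rightarrow> nat list \<Rightarrow> int"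
  and lookup_child :: "nat \<Rightarrow> (nat \<times> trie) list \<Rightarrow> nat list \<Rightarrow> int" where
  "lookup (Node v ts) [] = v"
| "lookup (Node v ts) (a # x) = lookup_child a ts x"
| "lookup_child a [] x = 0"
| "lookup_child a ((b, t) # ts) x = (if a = b then lookup t x else lookup_child a ts x)"

text \<open>One step of the recursion of \<open>clearing_count\<close>, with the previous counts
  read off the table \<open>T\<close>.\<close>

fun step_value :: "trie \<Rightarrow> nat list \<Rightarrow> nat list \<Rightarrow> int" where
  "step_value T [] x = lookup T (tl x)"
| "step_value T (a # A) x = lookup T (row_insert a x) + step_value T A x"

text \<open>\<open>p\<close> is the path to the current node, \<open>d\<close> the depth still
  allowed, and \<open>B\<close> the letters that may follow. The child for \<open>b\<close> keeps
  \<open>b\<close> and the letters after it, so paths are weakly increasing.\<close>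

fun step_trie :: "nat \<Rightarrow> trie \<Rightarrow> nat list \<Rightarrow> nat list \<Rightarrow> nat list \<Rightarrow> trie"
  and step_children :: "nat \<Rightarrow> trie \<Rightarrow> nat list \<Rightarrow> nat list \<Rightarrow> nat list \<Rightarrow> (nat \<times> trie) list" where
  "step_trie 0 T A B p = Node (step_value T A p) []"
| "step_trie (Suc d) T A B p = Node (step_value T A p) (step_children d T A B p)"
| "step_children d T A [] p = []"
| "step_children d T A (b # B) p =
     (b, step_trie d T A (b # B) (p @ [b])) # step_children d T A B p"

text \<open>With \<open>k\<close> steps to go, only lists of length at most \<open>k\<close> are looked up, and by
  \<open>clearing_count_eq_0\<close> those longer than the number of steps made need no entry.\<close>

fun clearing_table :: "nat list \<Rightarrow> nat \<Rightarrow> nat \<Rightarrow> trie \<Rightarrow> int list" where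
  "clearing_table A t 0 T = [lookup T []]"
| "clearing_table A t (Suc k) T =
     lookup T [] # clearing_table A (Suc t) k (step_trie (min (Suc t) k) T A A [])"

lemma step_value_eq: "step_value T A x = lookup T (tl x) + (\<Sum>a\<leftarrow>A. lookup T (row_insert a x))"
  by (induction A) auto

lemma lookup_step_trie:
  "\<lbrakk>sorted_wrt (<) B; sorted x; set x \<subseteq> set B\<rbrakk> \<Longrightarrow>
    lookup (step_trie d T A B p) x = (if length x \<le> d then step_value T A (p @ x) else 0)"
  "\<lbrakk>sorted_wrt (<) B; sorted (a # x); set (a # x) \<subseteq> set B\<rbrakk> \<Longrightarrow>
    lookup_child a (step_children d T A B p) x =
      (if length x \<le> d then step_value T A (p @ a # x) else 0)"
proof (induction d T A B p and d T A B p arbitrary: x and a x rule: step_trie_step_children.induct)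
  case (1 T A B p)
  then show ?case by (cases x) auto
next
  case (2 d T A B p)
  then show ?case by (cases x) auto
next
  case (4 d T A b B p)
  show ?case
  proof (cases "a = b")
    case True
    then show ?thesis using 4 by auto
  next
    case False
    \<comment> \<open>Here \<open>a\<close> lies in \<open>B\<close>, hence \<open>b < a\<close>,
      and the sorted list \<open>a # x\<close> stays above \<open>b\<close>.\<close>
    have "b \<notin> set x" using False 4 by fastforce
    then have "set (a # x) \<subseteq> set B" using False 4 by auto
    then show ?thesis using False 4 by auto
  qed
qed auto

text \<open>Invariant: \<open>T\<close> is correct on sorted lists of length at most
  \<open>k\<close>. A step looks up lists up to one longer than its argument, so the bound drops by
  one each time.\<close>

lemma clearing_table_eq:
  assumes "sorted_wrt (<) A"
    and "\<And>x. \<lbrakk>sorted x; set x \<subseteq> set A; length x \<le> k\<rbrakk> \<Longrightarrow> lookup T x = clearing_count A t x"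
  shows "clearing_table A t k T = map (\<lambda>i. clearing_count A i []) [t..<Suc (t + k)]"
  using assms(2)
proof (induction k arbitrary: t T)
  case 0
  then show ?case by simp
next
  case (Suc k)
  let ?T = "step_trie (min (Suc t) k) T A A []"
  have "lookup ?T x = clearing_count A (Suc t) x"
    if x: "sorted x" "set x \<subseteq> set A" "length x \<le> k" for x
  proof -
    have lookup: "lookup ?T x = (if length x \<le> min (Suc t) k then step_value T A x else 0)"
      using lookup_step_trie(1)[OF assms(1) x(1,2), of "min (Suc t) k" T A "[]"]
      by (simp only: append_Nil)
    have tl: "lookup T (tl x) = clearing_count A t (tl x)"
      using x by (intro Suc.prems) (cases x; auto)+
    have ins: "lookup T (row_insert a x) = clearing_count A t (row_insert a x)"
      if "a \<in> set A" for a
    proof (intro Suc.prems)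
      have "length (row_insert a y) \<le> Suc (length y)" for y
        by (induction y) auto
      then show "length (row_insert a x) \<le> Suc k" using x(3) by (meson Suc_le_mono le_trans)
    qed (use x that set_row_insert[of a x] in \<open>auto simp: sorted_row_insert\<close>)
    have "step_value T A x = clearing_count A (Suc t) x"
      using tl ins by (simp add: step_value_eq cong: map_cong)
    \<comment> \<open>Lists cut off by the depth \<open>Suc t\<close> have count 0, which is the
      default of the lookup.\<close>
    moreover have "clearing_count A (Suc t) x = 0" if "\<not> length x \<le> Suc t"
      using that clearing_count_eq_0[of "Suc t" x A] by (simp only: not_le)
    ultimately show ?thesis using x(3) lookup by auto
  qed
  then have "clearing_table A (Suc t) k ?T =
      map (\<lambda>i. clearing_count A i []) [Suc t..<Suc (Suc t + k)]"
    by (intro Suc.IH)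
  then show ?case
    using Suc.prems[of "[]"] by (simp add: upt_conv_Cons del: upt_Suc)
qed

text \<open>The initial trie \<open>Node 1 []\<close> describes zero steps: 1 on the empty list, and
  0 elsewhere by default.\<close>

lemma card_ones_row_words_table:
  assumes "n \<le> k"
  shows "int (card (ones_row_words n {1..Suc m})) = clearing_table [2..<Suc (Suc m)] 0 k (Node 1 []) ! n"
proof -
  let ?A = "[2..<Suc (Suc m)]"
  have "clearing_table ?A 0 k (Node 1 []) = map (\<lambda>i. clearing_count ?A i []) [0..<Suc (0 + k)]"
  proof (rule clearing_table_eq)
    show "lookup (Node 1 []) x = clearing_count ?A 0 x" for x
      by (cases x) auto
  qed (simp del: upt_Suc)
  then have "clearing_table ?A 0 k (Node 1 []) ! n = clearing_count ?A n []"
    using assms by (simp del: upt_Suc)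
  moreover have "{1..Suc m} = insert 1 (set ?A)"
    by auto
  moreover have "int (card (ones_row_words n (insert 1 (set ?A)))) = clearing_count ?A n []"
    by (rule card_ones_row_words_clearing) auto
  ultimately show ?thesis
    by (simp only:)
qed

section \<open>Numerical evaluation\<close>

text \<open>For the letters \<open>2, ..., m\<close>, entry \<open>n\<close> (counted from 0) is
  \<open>c_{n,m}(1)\<close>.\<close>

lemma clearing_table_values:
  "clearing_table [] 0 8 (Node 1 []) = [1, 1, 1, 1, 1, 1, 1, 1, 1]"
  "clearing_table [2] 0 8 (Node 1 []) = [1, 1, 2, 3, 6, 10, 20, 35, 70]"
  "clearing_table [2,3] 0 8 (Node 1 []) = [1, 1, 3, 6, 16, 40, 105, 280, 756]"
  "clearing_table [2,3,4] 0 8 (Node 1 []) = [1, 1, 4, 10, 32, 105, 345, 1176, 4088]"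
  "clearing_table [2,3,4,5] 0 8 (Node 1 []) = [1, 1, 5, 15, 55, 220, 871, 3556, 14980]"
  "clearing_table [2,3,4,5,6] 0 8 (Node 1 []) = [1, 1, 6, 21, 86, 401, 1857, 8778, 43064]"
  "clearing_table [2,3,4,5,6,7] 0 8 (Node 1 []) = [1, 1, 7, 28, 126, 665, 3521, 18858, 104952]"
  "clearing_table [2,3,4,5,6,7,8] 0 8 (Node 1 []) = [1, 1, 8, 36, 176, 1030, 6126, 36604, 226928]"
  by code_simp+

lemma clearing_table_binomial:
  assumes "0 < n" "n \<le> 8"
  shows "int (\<Sum>k<n. (i choose k) * packed_count n k) =
    clearing_table [2..<Suc (Suc i)] 0 8 (Node 1 []) ! n"
  using assms card_ones_row_words[of n "Suc i"] card_ones_row_words_table[of n 8 i] by simp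

text \<open>Pascal's rule in a form that rewrites numerals directly.\<close>

lemma numeral_choose_numeral:
  "numeral a choose numeral b = (pred_numeral a choose pred_numeral b) + (pred_numeral a choose numeral b)"
  by (simp add: numeral_eq_Suc)

lemma Suc_choose_numeral:
  "Suc m choose numeral b = (m choose pred_numeral b) + (m choose numeral b)"
  by (simp add: numeral_eq_Suc)

text \<open>For fixed \<open>n\<close>, the equations of \<open>clearing_table_binomial\<close> with
  \<open>i < n\<close> form a triangular system with diagonal \<open>i choose i = 1\<close>, which
  determines the packed counts.\<close>

lemma packed_count_values:
  "map (packed_count 1) [0] = [1]"
  "map (packed_count 2) [0, 1] = [1, 1]"
  "map (packed_count 3) [0, 1, 2] = [1, 2, 1]"
  "map (packed_count 4) [0, 1, 2, 3] = [1, 5, 5, 1]"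
  "map (packed_count 5) [0, 1, 2, 3, 4] = [1, 9, 21, 14, 1]"
  "map (packed_count 6) [0, 1, 2, 3, 4, 5] = [1, 19, 66, 89, 42, 1]"
  "map (packed_count 7) [0, 1, 2, 3, 4, 5, 6] = [1, 34, 211, 440, 393, 132, 1]"
  "map (packed_count 8) [0, 1, 2, 3, 4, 5, 6, 7] = [1, 69, 617, 2029, 2885, 1833, 429, 1]"
proof -
  note tables = clearing_table_binomial[of _ 0] clearing_table_binomial[of _ 1]
    clearing_table_binomial[of _ 2] clearing_table_binomial[of _ 3] clearing_table_binomial[of _ 4]
    clearing_table_binomial[of _ 5] clearing_table_binomial[of _ 6] clearing_table_binomial[of _ 7]
  note eval = clearing_table_values lessThan_nat_numeral numeral_choose_numeral binomial_eq_0 upt_rec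
  show "map (packed_count 1) [0] = [1]"
    using tables[of 1] by (simp add: eval)
  show "map (packed_count 2) [0, 1] = [1, 1]"
    using tables[of 2] by (simp add: eval)
  show "map (packed_count 3) [0, 1, 2] = [1, 2, 1]"
    using tables[of 3] by (simp add: eval)
  show "map (packed_count 4) [0, 1, 2, 3] = [1, 5, 5, 1]"
    using tables[of 4] by (simp add: eval)
  show "map (packed_count 5) [0, 1, 2, 3, 4] = [1, 9, 21, 14, 1]"
    using tables[of 5] by (simp add: eval)
  show "map (packed_count 6) [0, 1, 2, 3, 4, 5] = [1, 19, 66, 89, 42, 1]"
    using tables[of 6] by (simp add: eval)
  show "map (packed_count 7) [0, 1, 2, 3, 4, 5, 6] = [1, 34, 211, 440, 393, 132, 1]"
    using tables[of 7] by (simp add: eval)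
  show "map (packed_count 8) [0, 1, 2, 3, 4, 5, 6, 7] = [1, 69, 617, 2029, 2885, 1833, 429, 1]"
    using tables[of 8] by (simp add: eval)
qed

theorem theorem5p7:
  shows
    "(\<forall>m\<ge>1. centralizer_count 1 m [1] = 1) \<and>
     (\<forall>m\<ge>2. centralizer_count 2 m [1] = m choose 1) \<and>
     (\<forall>m\<ge>3. centralizer_count 3 m [1] = (m choose 1) + (m choose 2)) \<and>
     (\<forall>m\<ge>4. centralizer_count 4 m [1] = (m choose 1) + 4 * (m choose 2) + (m choose 3)) \<and>
     (\<forall>m\<ge>5. centralizer_count 5 m [1] =
        (m choose 1) + 8 * (m choose 2) + 13 * (m choose 3) + (m choose 4)) \<and>
     (\<forall>m\<ge>6. centralizer_count 6 m [1] =
        (m choose 1) + 18 * (m choose 2) + 48 * (m choose 3) + 41 * (m choose 4)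
        + (m choose 5)) \<and>
     (\<forall>m\<ge>7. centralizer_count 7 m [1] =
        (m choose 1) + 33 * (m choose 2) + 178 * (m choose 3) + 262 * (m choose 4)
        + 131 * (m choose 5) + (m choose 6)) \<and>
     (\<forall>m\<ge>8. centralizer_count 8 m [1] =
        (m choose 1) + 68 * (m choose 2) + 549 * (m choose 3) + 1480 * (m choose 4)
        + 1405 * (m choose 5) + 428 * (m choose 6) + (m choose 7))"
proof -
  \<comment> \<open>With \<open>Suc m\<close> as argument of \<open>f\<close>, Pascal's rule expands
    every \<open>Suc m choose j\<close> into binomials of \<open>m\<close>. For
    \<open>n \<ge> 2\<close> the packed counts are then sums of neighbouring coefficients of the
    claimed formula, such as 1, 1+4, 4+1, 1 for \<open>n = 4\<close>.\<close>
  have expand: "\<forall>m\<ge>n. centralizer_count n m [1] = f m"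
    if "0 < n" "\<And>m. (\<Sum>k<n. (m choose k) * packed_count n k) = f (Suc m)" for n f
  proof (intro allI impI)
    fix m assume "n \<le> m"
    then show "centralizer_count n m [1] = f m"
      using that(1) that(2)[of "m - 1"] by (simp add: centralizer_count_one card_ones_row_words del: One_nat_def)
  qed
  show ?thesis
    by (intro conjI expand;
        use packed_count_values in \<open>simp add: lessThan_nat_numeral Suc_choose_numeral\<close>)
qed

end
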